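(* Let $K$ be a field. For any $n\ge2$, the ring $R_n=R(K[X_1,\ldots,X_n])$ is not coherent. Hence it is non-Noetherian.
   Context: For an integral domain $T$, the reciprocal complement $R(T)$ is the subring of the fraction field of $T$ generated by all $1/f$ with $f\in T\setminus\{0\}$. Here $K[X_1,\ldots,X_n]$ is the polynomial ring in $n$ variables over $K$. A ring is coherent if every finitely generated ideal is finitely presented. *)

theory Defs
  imports
    "HOL-Algebra.Algebra"
    "HOL-Algebra.Algebraic_Closure_Type"
    "HOL-Library.Poly_Mapping"
    "HOL-Computational_Algebra.Fraction_Field"
begin

section \<open>The polynomial ring in \<open>n\<close> variables\<close>

text \<open>
  A polynomial in the variables \<open>X\<^sub>1, X\<^sub>2, \<dots>\<close> is a finitely supported function from monomials to
  coefficients, a monomial being a finitely supported function from variable indices to exponents.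
  \<open>polynomials n\<close> is the subring of those in which only \<open>X\<^sub>1, \<dots>, X\<^sub>n\<close> occur.
\<close>

definition polynomials :: "nat \<Rightarrow> ((nat \<Rightarrow>\<^sub>0 nat) \<Rightarrow>\<^sub>0 'k::field) set" where
  "polynomials n = {p. \<forall>m \<in> Poly_Mapping.keys p. Poly_Mapping.keys m \<subseteq> {1..n}}"

lemma polynomials_subring:
  "subring (polynomials n) (ring_of_type_algebra :: ((nat \<Rightarrow>\<^sub>0 nat) \<Rightarrow>\<^sub>0 'k::field) ring)"
    (is "subring _ ?P")
proof -
  interpret P: ring ?P by (rule ring_from_type_algebra)
  have ops: "carrier ?P = UNIV" "\<one>\<^bsub>?P\<^esub> = 1" "x \<oplus>\<^bsub>?P\<^esub> y = x + y" "x \<otimes>\<^bsub>?P\<^esub> y = x * y" for x y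
    by (simp_all add: ring_of_type_algebra_def)
  have neg: "\<ominus>\<^bsub>?P\<^esub> x = - x" for x
    by (rule P.minus_equality) (simp_all add: ring_of_type_algebra_def)
  show ?thesis
  proof (rule P.subringI)
    fix p q :: "(nat \<Rightarrow>\<^sub>0 nat) \<Rightarrow>\<^sub>0 'k"
    assume p: "p \<in> polynomials n" and q: "q \<in> polynomials n"
    show "p \<oplus>\<^bsub>?P\<^esub> q \<in> polynomials n"
      using p q Poly_Mapping.keys_add[of p q] by (fastforce simp: ops polynomials_def)
    show "p \<otimes>\<^bsub>?P\<^esub> q \<in> polynomials n"
      unfolding ops polynomials_def
    proof safe
      fix m i assume "m \<in> Poly_Mapping.keys (p * q)" and i: "i \<in> Poly_Mapping.keys m"
      then obtain a b where "m = a + b" "a \<in> Poly_Mapping.keys p" "b \<in> Poly_Mapping.keys q"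
        using keys_mult[of p q] by blast
      then show "i \<in> {1..n}"
        using p q i Poly_Mapping.keys_add[of a b] by (fastforce simp: polynomials_def)
    qed
  next
    fix p :: "(nat \<Rightarrow>\<^sub>0 nat) \<Rightarrow>\<^sub>0 'k"
    assume "p \<in> polynomials n"
    then show "\<ominus>\<^bsub>?P\<^esub> p \<in> polynomials n"
      by (simp add: neg polynomials_def)
  qed (auto simp: ops polynomials_def)
qed


section \<open>The reciprocal complement\<close>

text \<open>
  The integral domain \<open>T\<close> is given as a subring of an ambient integral domain \<open>'a\<close>, so that its
  fraction field is the subfield of \<open>'a fract\<close> consisting of the fractions with numerator and
  denominator in \<open>T\<close>; as \<open>reciprocal_complement_subset\<close> confirms, the ambient \<open>'a\<close>
  plays no further role.
\<close>

definition reciprocal_complement :: "'a::idom set \<Rightarrow> 'a fract ring" where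
  "reciprocal_complement T =
     ring_of_type_algebra
       \<lparr>carrier := generate_ring ring_of_type_algebra {1 / Fract f 1 | f. f \<in> T - {0}}\<rparr>"

lemma reciprocal_complement_domain: "domain (reciprocal_complement (T :: 'a::idom set))"
proof -
  interpret F: field "ring_of_type_algebra :: 'a fract ring"
    by (rule field_from_type_algebra)
  have "subring (generate_ring ring_of_type_algebra {1 / Fract f 1 | f. f \<in> T - {0}})
          (ring_of_type_algebra :: 'a fract ring)"
    by (rule F.generate_ring_is_subring) (simp add: ring_of_type_algebra_def)
  then show ?thesis
    unfolding reciprocal_complement_def by (rule F.subring_is_domain)
qed

lemma reciprocal_complement_subset:
  assumes "subring T (ring_of_type_algebra :: 'a::idom ring)"
  shows "carrier (reciprocal_complement T) \<subseteq> {Fract a b | a b. a \<in> T \<and> b \<in> T - {0}}"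
proof -
  let ?P = "ring_of_type_algebra :: 'a ring" and ?F = "ring_of_type_algebra :: 'a fract ring"
  interpret P: ring ?P by (rule ring_from_type_algebra)
  interpret F: ring ?F by (rule ring_from_type_algebra)
  have negP: "\<ominus>\<^bsub>?P\<^esub> x = - x" for x
    by (rule P.minus_equality) (simp_all add: ring_of_type_algebra_def)
  have negF: "\<ominus>\<^bsub>?F\<^esub> x = - x" for x
    by (rule F.minus_equality) (simp_all add: ring_of_type_algebra_def)
  have T: "1 \<in> T" "\<And>x. x \<in> T \<Longrightarrow> - x \<in> T"
    "\<And>x y. x \<in> T \<Longrightarrow> y \<in> T \<Longrightarrow> x + y \<in> T" "\<And>x y. x \<in> T \<Longrightarrow> y \<in> T \<Longrightarrow> x * y \<in> T"
    using subringE(3,5-7)[OF assms] by (simp_all add: negP) (simp_all add: ring_of_type_algebra_def)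
  have "\<exists>a b. x = Fract a b \<and> a \<in> T \<and> b \<in> T \<and> b \<noteq> 0"
    if "x \<in> generate_ring ?F {1 / Fract f 1 | f. f \<in> T - {0}}" for x
    using that
  proof (induction rule: generate_ring.induct)
    case one
    then show ?case using T(1) zero_neq_one[where 'a='a, symmetric]
      unfolding ring_of_type_algebra_def One_fract_def by (auto intro!: exI[of _ 1])
  next
    case (incl h)
    then show ?case using T(1) by (auto simp: One_fract_def)
  next
    case (a_inv h)
    then obtain a b where "h = Fract a b" "a \<in> T" "b \<in> T" "b \<noteq> 0" by blast
    then have "\<ominus>\<^bsub>?F\<^esub> h = Fract (- a) b" "- a \<in> T" "b \<in> T" "b \<noteq> 0"
      using T(2) by (simp_all add: negF)
    then show ?case by blast
  next
    case (eng_add h1 h2)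
    then obtain a b c d where "h1 = Fract a b" "a \<in> T" "b \<in> T" "b \<noteq> 0"
      "h2 = Fract c d" "c \<in> T" "d \<in> T" "d \<noteq> 0" by blast
    then have "h1 \<oplus>\<^bsub>?F\<^esub> h2 = Fract (a * d + c * b) (b * d)"
      "a * d + c * b \<in> T" "b * d \<in> T" "b * d \<noteq> 0"
      using T by (simp_all add: ring_of_type_algebra_def)
    then show ?case by blast
  next
    case (eng_mult h1 h2)
    then obtain a b c d where "h1 = Fract a b" "a \<in> T" "b \<in> T" "b \<noteq> 0"
      "h2 = Fract c d" "c \<in> T" "d \<in> T" "d \<noteq> 0" by blast
    then have "h1 \<otimes>\<^bsub>?F\<^esub> h2 = Fract (a * c) (b * d)" "a * c \<in> T" "b * d \<in> T" "b * d \<noteq> 0"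
      using T by (simp_all add: ring_of_type_algebra_def)
    then show ?case by blast
  qed
  then show ?thesis by (auto simp: reciprocal_complement_def)
qed


section \<open>Finitely presented modules and coherent rings\<close>

text \<open>
  Module records extend ring records; in the next two definitions the fields \<open>mult\<close> and \<open>one\<close>
  are not part of the module structure.
\<close>

definition free_module :: "('a, 'b) ring_scheme \<Rightarrow> nat \<Rightarrow> ('a, nat \<Rightarrow> 'a) module" where
  "free_module R n =
     \<lparr>carrier = {..<n} \<rightarrow>\<^sub>E carrier R,
      monoid.mult = (\<lambda>x y. \<lambda>i\<in>{..<n}. x i \<otimes>\<^bsub>R\<^esub> y i),
      one = (\<lambda>i\<in>{..<n}. \<one>\<^bsub>R\<^esub>),
      ring.zero = (\<lambda>i\<in>{..<n}. \<zero>\<^bsub>R\<^esub>),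
      add = (\<lambda>x y. \<lambda>i\<in>{..<n}. x i \<oplus>\<^bsub>R\<^esub> y i),
      module.smult = (\<lambda>a x. \<lambda>i\<in>{..<n}. a \<otimes>\<^bsub>R\<^esub> x i)\<rparr>"

definition ideal_module :: "('a, 'b) ring_scheme \<Rightarrow> 'a set \<Rightarrow> ('a, 'a) module" where
  "ideal_module R I =
     \<lparr>carrier = I, monoid.mult = monoid.mult R, one = one R, ring.zero = ring.zero R, add = add R,
      module.smult = monoid.mult R\<rparr>"

definition linear_maps ::
    "('a, 'r) ring_scheme \<Rightarrow> ('a, 'b, 'm) module_scheme \<Rightarrow> ('a, 'c, 'n) module_scheme \<Rightarrow> ('b \<Rightarrow> 'c) set"
  where
  "linear_maps R M N =
     {h \<in> carrier M \<rightarrow> carrier N.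
        (\<forall>x \<in> carrier M. \<forall>y \<in> carrier M. h (x \<oplus>\<^bsub>M\<^esub> y) = h x \<oplus>\<^bsub>N\<^esub> h y) \<and>
        (\<forall>a \<in> carrier R. \<forall>x \<in> carrier M. h (a \<odot>\<^bsub>M\<^esub> x) = a \<odot>\<^bsub>N\<^esub> h x)}"

text \<open>There is an exact sequence \<open>R\<^sup>m \<rightarrow> R\<^sup>n \<rightarrow> M \<rightarrow> 0\<close> with \<open>m\<close> and \<open>n\<close> finite.\<close>

definition finitely_presented :: "('a, 'r) ring_scheme \<Rightarrow> ('a, 'b, 'm) module_scheme \<Rightarrow> bool" where
  "finitely_presented R M \<longleftrightarrow>
     (\<exists>m n. \<exists>f \<in> linear_maps R (free_module R m) (free_module R n).
            \<exists>g \<in> linear_maps R (free_module R n) M.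
        f ` carrier (free_module R m) = {x \<in> carrier (free_module R n). g x = \<zero>\<^bsub>M\<^esub>} \<and>
        g ` carrier (free_module R n) = carrier M)"

text \<open>
  \<open>coherent_ring\<close> is meant for commutative rings and does not itself assert that \<open>R\<close> is one;
  so its negation for a reciprocal complement, which is always a domain, cannot hold vacuously.
\<close>

definition coherent_ring :: "('a, 'b) ring_scheme \<Rightarrow> bool" where
  "coherent_ring R \<longleftrightarrow>
     (\<forall>A. A \<subseteq> carrier R \<and> finite A \<longrightarrow> finitely_presented R (ideal_module R (Idl\<^bsub>R\<^esub> A)))"

lemma free_module_module:
  assumes "cring R" shows "module R (free_module R n)"
proof -
  interpret cring R by fact
  show ?thesis
  proof (rule moduleI)
    show "abelian_group (free_module R n)"
    proof (rule abelian_groupI)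
      fix x assume x: "x \<in> carrier (free_module R n)"
      show "\<exists>y\<in>carrier (free_module R n). y \<oplus>\<^bsub>free_module R n\<^esub> x = \<zero>\<^bsub>free_module R n\<^esub>"
        by (rule bexI[of _ "\<lambda>i\<in>{..<n}. \<ominus>\<^bsub>R\<^esub> x i"])
          (use x in \<open>auto simp: free_module_def PiE_iff l_neg fun_eq_iff\<close>)
    qed (auto simp: free_module_def PiE_iff extensional_def fun_eq_iff a_ac)
  qed (auto simp: free_module_def PiE_iff extensional_def fun_eq_iff l_distr r_distr m_assoc
            intro: assms)
qed

lemma ideal_module_module:
  assumes "cring R" "ideal I R" shows "module R (ideal_module R I)"
proof -
  interpret cring R by fact
  interpret I: ideal I R by fact
  show ?thesis
  proof (rule moduleI)
    show "abelian_group (ideal_module R I)"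
    proof (rule abelian_groupI)
      fix x assume x: "x \<in> carrier (ideal_module R I)"
      show "\<exists>y\<in>carrier (ideal_module R I). y \<oplus>\<^bsub>ideal_module R I\<^esub> x = \<zero>\<^bsub>ideal_module R I\<^esub>"
        by (rule bexI[of _ "\<ominus>\<^bsub>R\<^esub> x"]) (use x in \<open>auto simp: ideal_module_def l_neg I.Icarr\<close>)
    qed (auto simp: ideal_module_def I.Icarr a_ac)
  qed (auto simp: ideal_module_def I.Icarr l_distr r_distr m_assoc I.I_l_closed intro: assms)
qed

end

theory Submission
  imports Defs "HOL-Computational_Algebra.Formal_Laurent_Series"
begin

text \<open>
  Write \<open>X = X\<^sub>1\<close>, \<open>Y = X\<^sub>2\<close> and let \<open>R\<close> be the reciprocal complement. Both claims follow once
  the ideal \<open>J\<close> of those \<open>r \<in> R\<close> with \<open>r / Y \<in> R / X\<close> is shown not to be finitely generated. In a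
  Noetherian ring every ideal is finitely generated; in a coherent ring \<open>J\<close> is finitely generated
  because it is the set of first components of the syzygies of \<open>(1/Y, 1/X)\<close>
  (\<open>coherent_colon_finitely_generated\<close>).

  The elements \<open>1 / (X\<^sup>k + Y)\<close> with \<open>k \<ge> 1\<close> all lie in \<open>J\<close>, because
  \<open>X / (Y (X\<^sup>k + Y)) = (1 / Y - 1 / (X\<^sup>k + Y)) / X\<^bsup>k-1\<^esup>\<close>. That finitely many elements of \<open>J\<close> cannot generate all
  of them is seen at infinity, with respect to the grading in which \<open>X\<close> has weight \<open>1\<close>,
  \<open>Y\<close> has weight \<open>k\<close> and the other variables have weight \<open>0\<close>. Replacing \<open>X\<close> by \<open>X t\<^bsup>-1\<^esup>\<close> and \<open>Y\<close> by
  \<open>Y y t\<^bsup>-k\<^esup>\<close> embeds the field of rational functions into \<open>L((y))((t))\<close>, where \<open>L\<close> is that field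
  itself; the additional variable \<open>y\<close> records the degree in \<open>Y\<close>. Three facts are needed.

  \<^item> The image of any \<open>r \<in> R\<close> is a power series in \<open>t\<close>, and its coefficients at \<open>t\<^sup>i\<close> with \<open>i < k\<close> lie
    in \<open>L\<close>. Indeed, a polynomial \<open>f\<close> of weight less than \<open>k\<close> does not contain \<open>Y\<close>, and if its weight is
    at least \<open>k\<close>, then \<open>1 / f\<close> starts at \<open>t\<^sup>k\<close> or later.
  \<^item> For a fixed \<open>r \<in> R\<close> and all large \<open>k\<close> the coefficient at \<open>t\<^sup>k\<close> lies in \<open>L + L y\<^bsup>-1\<^esup>\<close>: as soon as \<open>k\<close>
    exceeds the degree in \<open>X\<close> of \<open>f\<close>, the part of \<open>f\<close> of weight \<open>k\<close> is \<open>Y\<close> times a polynomial in which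
    neither \<open>X\<close> nor \<open>Y\<close> occurs.
  \<^item> An element of \<open>J\<close> has constant coefficient \<open>0\<close>, by the first fact applied to \<open>r X / Y\<close>
    at \<open>t\<^bsup>k-1\<^esup>\<close>.

  By the first fact the elements of \<open>R\<close> with constant coefficient \<open>0\<close> and with coefficient at
  \<open>t\<^sup>k\<close> in \<open>L + L y\<^bsup>-1\<^esup>\<close> form an ideal. For large \<open>k\<close> it contains any given finite subset of \<open>J\<close>. But it
  does not contain \<open>1 / (X\<^sup>k + Y)\<close>, whose coefficient at \<open>t\<^sup>k\<close> is \<open>1 / (X\<^sup>k + Y y)\<close>.
\<close>

unbundle fps_syntax

section \<open>Colon ideals in coherent rings\<close>

definition unit_tuple :: "('a, 'b) ring_scheme \<Rightarrow> nat \<Rightarrow> nat \<Rightarrow> nat \<Rightarrow> 'a" where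
  "unit_tuple R n i = (\<lambda>j\<in>{..<n}. if j = i then \<one>\<^bsub>R\<^esub> else \<zero>\<^bsub>R\<^esub>)"

lemma (in cring) linear_map_coordinates:
  assumes I: "I \<subseteq> carrier R"
    and h: "h \<in> linear_maps R (free_module R n) (ideal_module R I)"
    and x: "x \<in> carrier (free_module R n)"
  shows "h x = (\<Oplus>i\<in>{..<n}. x i \<otimes> h (unit_tuple R n i))"
proof -
  have h_closed: "h y \<in> carrier R" if "y \<in> {..<n} \<rightarrow>\<^sub>E carrier R" for y
    using h I that by (auto simp: linear_maps_def free_module_def ideal_module_def)
  have h_add: "h (\<lambda>i\<in>{..<n}. y i \<oplus> z i) = h y \<oplus> h z"
    if "y \<in> {..<n} \<rightarrow>\<^sub>E carrier R" "z \<in> {..<n} \<rightarrow>\<^sub>E carrier R" for y z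
    using h that by (auto simp: linear_maps_def free_module_def ideal_module_def)
  have h_smult: "h (\<lambda>i\<in>{..<n}. c \<otimes> y i) = c \<otimes> h y"
    if "c \<in> carrier R" "y \<in> {..<n} \<rightarrow>\<^sub>E carrier R" for c y
    using h that by (auto simp: linear_maps_def free_module_def ideal_module_def)
  have unit: "unit_tuple R n i \<in> {..<n} \<rightarrow>\<^sub>E carrier R" for i
    by (auto simp: unit_tuple_def)
  have "h y = (\<Oplus>i\<in>{..<k}. y i \<otimes> h (unit_tuple R n i))"
    if "y \<in> {..<n} \<rightarrow>\<^sub>E carrier R" "k \<le> n" "\<And>i. k \<le> i \<Longrightarrow> i < n \<Longrightarrow> y i = \<zero>" for k y
    using that
  proof (induction k arbitrary: y)
    case 0
    have "y = (\<lambda>i\<in>{..<n}. \<zero> \<otimes> y i)"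
      using 0 by (auto simp: fun_eq_iff PiE_iff extensional_def)
    then have "h y = \<zero> \<otimes> h y"
      using h_smult[OF zero_closed 0(1)] by argo
    then show ?case using h_closed[OF 0(1)] by simp
  next
    case (Suc k)
    define z where "z = y(k := \<zero>)"
    have k: "k < n" using Suc.prems by simp
    have yk: "y k \<in> carrier R" using Suc.prems(1) k by auto
    have z: "z \<in> {..<n} \<rightarrow>\<^sub>E carrier R"
      using Suc.prems(1) k by (auto simp: z_def PiE_iff extensional_def)
    let ?u = "\<lambda>i\<in>{..<n}. y k \<otimes> unit_tuple R n k i"
    have u: "?u \<in> {..<n} \<rightarrow>\<^sub>E carrier R" using yk by (auto simp: unit_tuple_def)
    have y_split: "y = (\<lambda>i\<in>{..<n}. z i \<oplus> ?u i)"
      using Suc.prems(1) k yk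
      by (auto simp: fun_eq_iff PiE_iff extensional_def z_def unit_tuple_def)
    have h_split: "h y = h z \<oplus> y k \<otimes> h (unit_tuple R n k)"
      by (subst y_split) (simp add: h_add[OF z u] h_smult[OF yk unit] del: restrict_apply)
    have closed: "y i \<otimes> h (unit_tuple R n i) \<in> carrier R" if "i < Suc k" for i
      using PiE_mem[OF Suc.prems(1), of i] h_closed[OF unit] k that by simp
    have "h z = (\<Oplus>i\<in>{..<k}. z i \<otimes> h (unit_tuple R n i))"
    proof (rule Suc.IH[OF z])
      show "z i = \<zero>" if "k \<le> i" "i < n" for i
        using that Suc.prems(3)[of i] by (cases "i = k") (auto simp: z_def)
    qed (use k in simp)
    moreover have "\<dots> = (\<Oplus>i\<in>{..<k}. y i \<otimes> h (unit_tuple R n i))"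
      using closed by (intro finsum_cong') (auto simp: z_def)
    moreover have "(\<Oplus>i\<in>{..<Suc k}. y i \<otimes> h (unit_tuple R n i))
        = y k \<otimes> h (unit_tuple R n k) \<oplus> (\<Oplus>i\<in>{..<k}. y i \<otimes> h (unit_tuple R n i))"
      unfolding lessThan_Suc by (rule finsum_insert) (use closed in auto)
    moreover have "(\<Oplus>i\<in>{..<k}. y i \<otimes> h (unit_tuple R n i)) \<in> carrier R"
      using closed by (intro finsum_closed) auto
    ultimately show ?case
      using h_split closed[of k] by (simp only: a_comm lessI)
  qed
  from this[of x n] show ?thesis using x by (simp add: free_module_def)
qed

lemma (in ideal) finsum_mem:
  assumes "finite A" "\<And>i. i \<in> A \<Longrightarrow> f i \<in> I"
  shows "(\<Oplus>i\<in>A. f i) \<in> I"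
  using assms
proof (induction rule: finite_induct)
  case (insert i A)
  then show ?case
    by (subst finsum_insert) (auto intro: additive_subgroup.a_closed Icarr)
qed auto

lemma (in cring) genideal_pair:
  assumes a: "a \<in> carrier R" and b: "b \<in> carrier R" and x: "x \<in> Idl {a, b}"
  obtains p q where "p \<in> carrier R" "q \<in> carrier R" "x = p \<otimes> a \<oplus> q \<otimes> b"
proof -
  have "Idl {a, b} \<subseteq> PIdl a <+> PIdl b"
  proof (rule genideal_minimal)
    show "ideal (PIdl a <+> PIdl b) R"
      using a b by (intro add_ideals cgenideal_ideal)
    have "a = a \<oplus> \<zero>" "b = \<zero> \<oplus> b" using a b by auto
    moreover have "\<zero> \<in> PIdl a" "\<zero> \<in> PIdl b"
      using cgenideal_ideal a b additive_subgroup.zero_closed ideal.axioms(1) by blast+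
    ultimately show "{a, b} \<subseteq> PIdl a <+> PIdl b"
      using cgenideal_self[OF a] cgenideal_self[OF b] by (auto simp: set_add_def')
  qed
  then obtain u v where "u \<in> PIdl a" "v \<in> PIdl b" "x = u \<oplus> v"
    using x by (auto simp: set_add_def')
  then show thesis using that by (auto simp: cgenideal_def)
qed

lemma (in cring) ideal_if_closed:
  assumes "I \<subseteq> carrier R" "I \<noteq> {}" "\<And>x y. x \<in> I \<Longrightarrow> y \<in> I \<Longrightarrow> x \<oplus> y \<in> I"
    "\<And>c x. c \<in> carrier R \<Longrightarrow> x \<in> I \<Longrightarrow> c \<otimes> x \<in> I"
  shows "ideal I R"
proof (rule idealI)
  show "subgroup I (add_monoid R)"
  proof (rule add.subgroupI)
    fix x assume "x \<in> I"
    then show "\<ominus> x \<in> I" using assms(1) assms(4)[of "\<ominus> \<one>" x] by (auto simp: l_minus)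
  qed (use assms in auto)
  show "x \<otimes> a \<in> I" if "a \<in> I" "x \<in> carrier R" for a x
    using that assms by auto
  show "a \<otimes> x \<in> I" if "a \<in> I" "x \<in> carrier R" for a x
    using that assms(1) assms(4)[of x a] m_comm[of a x] by auto
qed (rule ring_axioms)

lemma (in cring) colon_ideal:
  assumes a: "a \<in> carrier R" and b: "b \<in> carrier R"
  shows "ideal {r \<in> carrier R. \<exists>s\<in>carrier R. r \<otimes> a = s \<otimes> b} R" (is "ideal ?J R")
proof (rule ideal_if_closed)
  have memI: "r \<in> ?J" if "r \<in> carrier R" "s \<in> carrier R" "r \<otimes> a = s \<otimes> b" for r s
    using that by auto
  have "\<zero> \<in> ?J" by (rule memI[of \<zero> \<zero>]) (use a b in simp_all)
  then show "?J \<noteq> {}" by blast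
  fix r assume "r \<in> ?J"
  then obtain s where r: "r \<in> carrier R" "s \<in> carrier R" "r \<otimes> a = s \<otimes> b" by auto
  show "r \<oplus> r' \<in> ?J" if r': "r' \<in> ?J" for r'
  proof -
    obtain s' where "r' \<in> carrier R" "s' \<in> carrier R" "r' \<otimes> a = s' \<otimes> b" using r' by blast
    then show ?thesis using memI[of "r \<oplus> r'" "s \<oplus> s'"] r a b by (simp add: l_distr)
  qed
  show "c \<otimes> r \<in> ?J" if "c \<in> carrier R" for c
    using that r a b by (intro memI[of _ "c \<otimes> s"]) (simp_all add: m_assoc)
qed auto

text \<open>
  The left-hand ideal consists of the first components of the relations \<open>r a - s b = 0\<close>. A finite
  presentation \<open>f, g\<close> of the ideal \<open>(a, b)\<close> need not use the generators \<open>a\<close> and \<open>b\<close>, so it is compared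
  with them, as in Schanuel's lemma. The map \<open>g\<close> is lifted to \<open>(P, Q)\<close> with \<open>g x = P x a + Q x b\<close>, and
  \<open>u, v\<close> are preimages of \<open>a, b\<close> under \<open>g\<close>. For a relation \<open>r a = s b\<close> the tuple \<open>r u - s v\<close> lies in the
  kernel of \<open>g\<close>, hence equals some \<open>f z\<close>, and applying \<open>P\<close> gives
  \<open>r = P (f z) - r (P u - 1) + s P v\<close>. So the values of \<open>P \<circ> f\<close> at the unit tuples together with
  \<open>P u - 1\<close> and \<open>P v\<close> generate.
\<close>
lemma (in cring) coherent_colon_finitely_generated:
  assumes coh: "coherent_ring R" and a: "a \<in> carrier R" and b: "b \<in> carrier R"
  shows "\<exists>G\<subseteq>carrier R. finite G \<and> {r \<in> carrier R. \<exists>s\<in>carrier R. r \<otimes> a = s \<otimes> b} = Idl G"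
proof -
  let ?J = "{r \<in> carrier R. \<exists>s\<in>carrier R. r \<otimes> a = s \<otimes> b}"
  let ?I = "Idl {a, b}"
  interpret I: ideal ?I R by (rule genideal_ideal) (simp add: a b)
  have IR: "?I \<subseteq> carrier R" by (rule I.a_subset)
  obtain m n f g
    where f: "f \<in> linear_maps R (free_module R m) (free_module R n)"
      and g: "g \<in> linear_maps R (free_module R n) (ideal_module R ?I)"
      and exact: "f ` carrier (free_module R m) = {x \<in> carrier (free_module R n). g x = \<zero>}"
      and onto: "g ` carrier (free_module R n) = ?I"
  proof -
    have "finitely_presented R (ideal_module R ?I)"
      using coh[unfolded coherent_ring_def, rule_format, of "{a, b}"] a b by blast
    moreover have "\<zero>\<^bsub>ideal_module R ?I\<^esub> = \<zero>" "carrier (ideal_module R ?I) = ?I"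
      by (simp_all add: ideal_module_def)
    ultimately have "\<exists>m n. \<exists>f\<in>linear_maps R (free_module R m) (free_module R n).
        \<exists>g\<in>linear_maps R (free_module R n) (ideal_module R ?I).
          f ` carrier (free_module R m) = {x \<in> carrier (free_module R n). g x = \<zero>} \<and>
          g ` carrier (free_module R n) = ?I"
      by (simp only: finitely_presented_def)
    then show thesis
      by (elim exE bexE conjE) (rule that)
  qed
  let ?F = "\<lambda>k. {..<k::nat} \<rightarrow>\<^sub>E carrier R"
  have F: "carrier (free_module R k) = ?F k" for k by (simp add: free_module_def)
  have unit: "unit_tuple R k i \<in> ?F k" for k i by (auto simp: unit_tuple_def)
  have g_add: "g (\<lambda>i\<in>{..<n}. y i \<oplus> z i) = g y \<oplus> g z" if "y \<in> ?F n" "z \<in> ?F n" for y z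
    using g that by (auto simp: linear_maps_def free_module_def ideal_module_def)
  have g_smult: "g (\<lambda>i\<in>{..<n}. c \<otimes> y i) = c \<otimes> g y" if "c \<in> carrier R" "y \<in> ?F n" for c y
    using g that by (auto simp: linear_maps_def free_module_def ideal_module_def)
  have f_add: "f (\<lambda>i\<in>{..<m}. y i \<oplus> z i) = (\<lambda>i\<in>{..<n}. f y i \<oplus> f z i)"
    if "y \<in> ?F m" "z \<in> ?F m" for y z
    using f that by (auto simp: linear_maps_def free_module_def)
  have f_smult: "f (\<lambda>i\<in>{..<m}. c \<otimes> y i) = (\<lambda>i\<in>{..<n}. c \<otimes> f y i)"
    if "c \<in> carrier R" "y \<in> ?F m" for c y
    using f that by (auto simp: linear_maps_def free_module_def)
  have f_closed: "f y \<in> ?F n" if "y \<in> ?F m" for y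
    using f that by (auto simp: linear_maps_def F)
  have gR: "g x \<in> ?I" if "x \<in> ?F n" for x
    using onto that by (auto simp: F)
  have "a \<in> ?I" "b \<in> ?I" using genideal_self[of "{a, b}"] a b by blast+
  then obtain u v where u: "u \<in> ?F n" "g u = a" and v: "v \<in> ?F n" "g v = b"
    unfolding onto[symmetric] F by (elim imageE) (rule that; simp)
  have "\<forall>i. \<exists>c. fst c \<in> carrier R \<and> snd c \<in> carrier R \<and> g (unit_tuple R n i) = fst c \<otimes> a \<oplus> snd c \<otimes> b"
  proof
    fix i
    obtain p q where "p \<in> carrier R" "q \<in> carrier R" "g (unit_tuple R n i) = p \<otimes> a \<oplus> q \<otimes> b"
      by (rule genideal_pair[OF a b gR[OF unit[of n i]]])
    then show "\<exists>c. fst c \<in> carrier R \<and> snd c \<in> carrier R \<and> g (unit_tuple R n i) = fst c \<otimes> a \<oplus> snd c \<otimes> b"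
      by (intro exI[of _ "(p, q)"]) simp
  qed
  from choice[OF this] obtain c where c: "\<forall>i. fst (c i) \<in> carrier R \<and> snd (c i) \<in> carrier R
      \<and> g (unit_tuple R n i) = fst (c i) \<otimes> a \<oplus> snd (c i) \<otimes> b"
    by (elim exE) (rule that)
  define p q where "p = (\<lambda>i. fst (c i))" and "q = (\<lambda>i. snd (c i))"
  have pq: "p i \<in> carrier R" "q i \<in> carrier R" "g (unit_tuple R n i) = p i \<otimes> a \<oplus> q i \<otimes> b" for i
    using c by (simp_all add: p_def q_def)
  define P Q where "P = (\<lambda>x. \<Oplus>i\<in>{..<n}. x i \<otimes> p i)" and "Q = (\<lambda>x. \<Oplus>i\<in>{..<n}. x i \<otimes> q i)"
  have PQ_closed: "P x \<in> carrier R" "Q x \<in> carrier R" if "x \<in> ?F n" for x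
    using that pq unfolding P_def Q_def by (auto intro!: finsum_closed)
  have P_add: "P (\<lambda>i\<in>{..<n}. x i \<oplus> y i) = P x \<oplus> P y" if "x \<in> ?F n" "y \<in> ?F n" for x y
  proof -
    have "P (\<lambda>i\<in>{..<n}. x i \<oplus> y i) = (\<Oplus>i\<in>{..<n}. x i \<otimes> p i \<oplus> y i \<otimes> p i)"
      unfolding P_def using that pq by (intro finsum_cong') (auto simp: PiE_iff l_distr Pi_iff)
    then show ?thesis
      unfolding P_def using that pq by (subst finsum_addf[symmetric]) (auto simp: Pi_iff)
  qed
  have P_smult: "P (\<lambda>i\<in>{..<n}. c \<otimes> x i) = c \<otimes> P x" if "c \<in> carrier R" "x \<in> ?F n" for c x
  proof -
    have "P (\<lambda>i\<in>{..<n}. c \<otimes> x i) = (\<Oplus>i\<in>{..<n}. c \<otimes> (x i \<otimes> p i))"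
      unfolding P_def using that pq by (intro finsum_cong') (auto simp: PiE_iff m_assoc Pi_iff)
    then show ?thesis
      unfolding P_def using that pq by (subst finsum_rdistr) (auto simp: Pi_iff)
  qed
  have g_PQ: "g x = P x \<otimes> a \<oplus> Q x \<otimes> b" if x: "x \<in> ?F n" for x
  proof -
    have "g x = (\<Oplus>i\<in>{..<n}. x i \<otimes> g (unit_tuple R n i))"
      by (rule linear_map_coordinates[OF IR g]) (use x in \<open>simp add: F\<close>)
    also have "\<dots> = (\<Oplus>i\<in>{..<n}. (x i \<otimes> p i) \<otimes> a \<oplus> (x i \<otimes> q i) \<otimes> b)"
      using x pq a b by (intro finsum_cong') (auto simp: PiE_iff Pi_iff r_distr m_assoc)
    also have "\<dots> = P x \<otimes> a \<oplus> Q x \<otimes> b"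
      unfolding P_def Q_def using x pq a b
      by (subst finsum_addf) (auto simp: Pi_iff PiE_iff finsum_ldistr)
    finally show ?thesis .
  qed
  have mem_J: "r \<in> ?J" if "r \<in> carrier R" "s \<in> carrier R" "r \<otimes> a \<oplus> s \<otimes> b = \<zero>" for r s
  proof -
    have "r \<otimes> a = (\<ominus> s) \<otimes> b"
      using that a b by (simp add: l_minus) (metis minus_equality m_closed minus_minus)
    then show ?thesis using that by auto
  qed
  define G where "G = insert (P u \<ominus> \<one>) (insert (P v) ((\<lambda>j. P (f (unit_tuple R m j))) ` {..<m}))"
  have "G \<subseteq> ?J"
  proof -
    have "(P u \<ominus> \<one>) \<otimes> a \<oplus> Q u \<otimes> b = \<zero>"
    proof -
      have "(P u \<ominus> \<one>) \<otimes> a \<oplus> Q u \<otimes> b = (P u \<otimes> a \<oplus> Q u \<otimes> b) \<ominus> a"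
        using a b PQ_closed[OF u(1)] by (simp add: a_minus_def l_distr l_minus a_ac)
      then show ?thesis using g_PQ[OF u(1)] u(2) a by (simp add: a_minus_def r_neg)
    qed
    then have 1: "P u \<ominus> \<one> \<in> ?J" using PQ_closed[OF u(1)] by (intro mem_J[of _ "Q u"]) auto
    have "P v \<otimes> a \<oplus> (Q v \<ominus> \<one>) \<otimes> b = \<zero>"
    proof -
      have "P v \<otimes> a \<oplus> (Q v \<ominus> \<one>) \<otimes> b = (P v \<otimes> a \<oplus> Q v \<otimes> b) \<ominus> b"
        using a b PQ_closed[OF v(1)] by (simp add: a_minus_def l_distr l_minus a_ac)
      then show ?thesis using g_PQ[OF v(1)] v(2) b by (simp add: a_minus_def r_neg)
    qed
    then have 2: "P v \<in> ?J" using PQ_closed[OF v(1)] by (intro mem_J[of _ "Q v \<ominus> \<one>"]) auto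
    have "P (f (unit_tuple R m j)) \<in> ?J" for j
    proof (rule mem_J[of _ "Q (f (unit_tuple R m j))"])
      have "g (f (unit_tuple R m j)) = \<zero>"
        using exact unit[of m j] unfolding F by blast
      then show "P (f (unit_tuple R m j)) \<otimes> a \<oplus> Q (f (unit_tuple R m j)) \<otimes> b = \<zero>"
        using g_PQ[OF f_closed[OF unit]] by simp
    qed (use PQ_closed f_closed unit in auto)
    then show ?thesis using 1 2 by (auto simp: G_def)
  qed
  then have G: "G \<subseteq> carrier R" "finite G" by (auto simp: G_def)
  interpret G: ideal "Idl G" R by (rule genideal_ideal[OF G(1)])
  have gens: "x \<in> Idl G" if "x \<in> G" for x using genideal_self[OF G(1)] that by auto
  have Pf: "P (f z) \<in> Idl G" if z: "z \<in> ?F m" for z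
  proof -
    have "P (f (\<lambda>i\<in>{..<m}. y i \<oplus> z i)) = P (f y) \<oplus> P (f z)" if "y \<in> ?F m" "z \<in> ?F m" for y z
      by (simp only: f_add[OF that] P_add[OF f_closed[OF that(1)] f_closed[OF that(2)]])
    moreover have "P (f (\<lambda>i\<in>{..<m}. c \<otimes> y i)) = c \<otimes> P (f y)" if "c \<in> carrier R" "y \<in> ?F m" for c y
      by (simp only: f_smult[OF that] P_smult[OF that(1) f_closed[OF that(2)]])
    moreover have "P (f y) \<in> carrier R" if "y \<in> ?F m" for y
      using that by (intro PQ_closed f_closed)
    ultimately have "(\<lambda>z. P (f z)) \<in> linear_maps R (free_module R m) (ideal_module R (carrier R))"
      unfolding linear_maps_def free_module_def ideal_module_def by simp
    from linear_map_coordinates[OF subset_refl this, of z]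
    have "P (f z) = (\<Oplus>j\<in>{..<m}. z j \<otimes> P (f (unit_tuple R m j)))" using z by (simp add: F)
    moreover have "z j \<otimes> P (f (unit_tuple R m j)) \<in> Idl G" if "j \<in> {..<m}" for j
      using that unfolding G_def
      by (intro G.I_l_closed[unfolded G_def] gens[unfolded G_def] PiE_mem[OF z]) blast+
    then have "(\<Oplus>j\<in>{..<m}. z j \<otimes> P (f (unit_tuple R m j))) \<in> Idl G"
      by (intro G.finsum_mem) simp_all
    ultimately show ?thesis by argo
  qed
  have "?J \<subseteq> Idl G"
  proof
    fix r assume "r \<in> ?J"
    then obtain s where r: "r \<in> carrier R" and s: "s \<in> carrier R" and rs: "r \<otimes> a = s \<otimes> b" by auto
    let ?x = "\<lambda>i\<in>{..<n}. r \<otimes> u i" and ?y = "\<lambda>i\<in>{..<n}. (\<ominus> s) \<otimes> v i"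
    let ?w = "\<lambda>i\<in>{..<n}. ?x i \<oplus> ?y i"
    have xy: "?x \<in> ?F n" "?y \<in> ?F n" using r s u v by auto
    have w: "?w \<in> ?F n" using PiE_mem[OF xy(1)] PiE_mem[OF xy(2)] by (intro restrict_PiE_iff[THEN iffD2] ballI a_closed)
    have "g ?w = r \<otimes> a \<oplus> (\<ominus> s) \<otimes> b"
      by (simp only: g_add[OF xy] g_smult[OF r u(1)] g_smult[OF a_inv_closed[OF s] v(1)] u(2) v(2))
    also have "\<dots> = \<zero>" using rs a b r s by (simp add: l_minus r_neg)
    finally have "?w \<in> f ` ?F m" unfolding exact[unfolded F] by (intro CollectI conjI w)
    then obtain z where z: "z \<in> ?F m" "?w = f z" by (rule imageE)
    have "P ?w = r \<otimes> P u \<oplus> (\<ominus> s) \<otimes> P v"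
      by (simp only: P_add[OF xy] P_smult[OF r u(1)] P_smult[OF a_inv_closed[OF s] v(1)])
    then have Pfz: "P (f z) = r \<otimes> P u \<oplus> (\<ominus> s) \<otimes> P v" unfolding z(2) .
    have "r = P (f z) \<oplus> (\<ominus> r) \<otimes> (P u \<ominus> \<one>) \<oplus> s \<otimes> P v"
      unfolding Pfz using r s PQ_closed[OF u(1)] PQ_closed[OF v(1)] by algebra
    moreover have "\<dots> \<in> Idl G"
      using r s by (intro G.a_closed Pf z G.I_l_closed gens a_inv_closed) (auto simp: G_def)
    ultimately show "r \<in> Idl G" by argo
  qed
  moreover have "Idl G \<subseteq> ?J" using \<open>G \<subseteq> ?J\<close> by (intro genideal_minimal colon_ideal a b)
  ultimately show ?thesis using G by blast
qed


section \<open>Weighted expansion at infinity\<close>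


text \<open>
  The variables other than \<open>X\<^sub>1\<close> and \<open>X\<^sub>2\<close> have weight \<open>0\<close>.
\<close>
definition weight :: "nat \<Rightarrow> (nat \<Rightarrow>\<^sub>0 nat) \<Rightarrow> nat" where
  "weight k m = Poly_Mapping.lookup m 1 + k * Poly_Mapping.lookup m 2"

type_synonym 'k ratfun = "((nat \<Rightarrow>\<^sub>0 nat) \<Rightarrow>\<^sub>0 'k) fract"

definition term_coeff :: "(nat \<Rightarrow>\<^sub>0 nat) \<Rightarrow> 'k::field \<Rightarrow> 'k ratfun fls" where
  "term_coeff m c = fls_X ^ Poly_Mapping.lookup m 2 * fls_const (Fract (Poly_Mapping.single m c) 1)"

text \<open>
  The outer series are in \<open>t\<close>, the inner ones in \<open>y\<close>. As \<open>t = 0\<close> is the place at infinity,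
  monomials of positive weight have poles in \<open>t\<close>. The monomial itself is kept as a constant, which makes the
  image of a polynomial visibly nonzero: setting \<open>t = y = 1\<close> recovers it.
\<close>
definition term_expansion :: "nat \<Rightarrow> (nat \<Rightarrow>\<^sub>0 nat) \<Rightarrow> 'k::field \<Rightarrow> 'k ratfun fls fls" where
  "term_expansion k m c = fls_X_inv ^ weight k m * fls_const (term_coeff m c)"

definition expansion :: "nat \<Rightarrow> ((nat \<Rightarrow>\<^sub>0 nat) \<Rightarrow>\<^sub>0 'k::field) \<Rightarrow> 'k ratfun fls fls" where
  "expansion k p = (\<Sum>m\<in>Poly_Mapping.keys p. term_expansion k m (Poly_Mapping.lookup p m))"

lemma Fract_add_1: "Fract (a + b) 1 = Fract a 1 + Fract b (1 :: 'a::idom)"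
  by simp

lemma Fract_mult_1: "Fract (a * b) 1 = Fract a 1 * Fract b (1 :: 'a::idom)"
  by simp

lemma term_expansion_add: "term_expansion k m (a + b) = term_expansion k m a + term_expansion k m b"
  by (simp only: term_expansion_def term_coeff_def single_add Fract_add_1
      fls_plus_const[symmetric] distrib_left)

lemma term_expansion_0 [simp]: "term_expansion k m 0 = 0"
  by (simp add: term_expansion_def term_coeff_def Zero_fract_def[symmetric])

lemma term_expansion_mult:
  "term_expansion k (m + m') (a * b) = term_expansion k m a * term_expansion k m' b"
proof -
  have "term_coeff (m + m') (a * b) = term_coeff m a * term_coeff m' b"
    by (simp only: term_coeff_def mult_single[symmetric] Fract_mult_1 fls_const_mult_const[symmetric]
        lookup_add power_add mult.assoc mult.left_commute)
  moreover have "weight k (m + m') = weight k m + weight k m'"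
    by (simp add: weight_def lookup_add distrib_left)
  ultimately show ?thesis
    by (simp only: term_expansion_def fls_const_mult_const[symmetric] power_add mult.assoc mult.left_commute)
qed

lemma expansion_superset:
  assumes "finite S" "Poly_Mapping.keys p \<subseteq> S"
  shows "expansion k p = (\<Sum>m\<in>S. term_expansion k m (Poly_Mapping.lookup p m))"
  unfolding expansion_def using assms
  by (intro sum.mono_neutral_left) (auto simp: in_keys_iff)

lemma expansion_add: "expansion k (p + q) = expansion k p + expansion k q"
proof -
  let ?S = "Poly_Mapping.keys p \<union> Poly_Mapping.keys q"
  have "Poly_Mapping.keys (p + q) \<subseteq> ?S" by (rule Poly_Mapping.keys_add)
  then show ?thesis
    by (simp add: expansion_superset[of ?S] lookup_add term_expansion_add sum.distrib)
qed

lemma expansion_0 [simp]: "expansion k 0 = 0"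
  by (simp add: expansion_def)

lemma expansion_sum: "expansion k (sum f A) = (\<Sum>i\<in>A. expansion k (f i))"
  by (induction A rule: infinite_finite_induct) (simp_all add: expansion_add)

lemma expansion_single: "expansion k (Poly_Mapping.single m c) = term_expansion k m c"
  by (simp add: expansion_def)

lemma poly_mapping_sum_singles: "p = (\<Sum>m\<in>Poly_Mapping.keys p. Poly_Mapping.single m (Poly_Mapping.lookup p m))"
  by (rule poly_mapping_eqI) (simp add: lookup_sum lookup_single when_def in_keys_iff)

lemma expansion_mult: "expansion k (p * q) = expansion k p * expansion k q"
proof -
  have "p * q = (\<Sum>m\<in>Poly_Mapping.keys p. Poly_Mapping.single m (Poly_Mapping.lookup p m)) *
      (\<Sum>m\<in>Poly_Mapping.keys q. Poly_Mapping.single m (Poly_Mapping.lookup q m))"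
    by (simp flip: poly_mapping_sum_singles)
  then have "expansion k (p * q) =
      expansion k (\<Sum>m\<in>Poly_Mapping.keys p. \<Sum>m'\<in>Poly_Mapping.keys q. Poly_Mapping.single (m + m') (Poly_Mapping.lookup p m * Poly_Mapping.lookup q m'))"
    by (simp add: sum_product mult_single)
  then show ?thesis
    by (simp only: expansion_sum expansion_single term_expansion_mult expansion_def[of k p]
        expansion_def[of k q] sum_product)
qed

lemma expansion_1: "expansion k 1 = 1"
proof -
  have "expansion k (Poly_Mapping.single 0 1) = 1"
    by (simp only: expansion_single) (simp add: term_expansion_def term_coeff_def weight_def One_fract_def[symmetric])
  then show ?thesis by simp
qed

lemma term_expansion_nth:
  "term_expansion k m c $$ i = (if i = - int (weight k m) then term_coeff m c else 0)"
  by (auto simp: term_expansion_def fls_X_inv_power_times_conv_shift)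

lemma expansion_nth:
  "expansion k p $$ (- int d) = (\<Sum>m\<in>{m \<in> Poly_Mapping.keys p. weight k m = d}. term_coeff m (Poly_Mapping.lookup p m))"
  by (simp add: expansion_def fls_nth_sum term_expansion_nth sum.If_cases Int_def eq_commute)

text \<open>
  No cancellation is possible between different monomials, since each of them is still present in
  its coefficient; it suffices to look at those with the same exponent of \<open>t\<close> and of \<open>y\<close> as \<open>m\<close>.
\<close>
lemma expansion_nth_weight_nonzero:
  assumes "m \<in> Poly_Mapping.keys p"
  shows "expansion k p $$ (- int (weight k m)) \<noteq> 0"
proof -
  let ?S = "{m' \<in> Poly_Mapping.keys p. weight k m' = weight k m \<and> Poly_Mapping.lookup m' 2 = Poly_Mapping.lookup m 2}"
  have tc: "term_coeff m' c $$ int j = (if Poly_Mapping.lookup m' 2 = j then Fract (Poly_Mapping.single m' c) 1 else 0)" for m' c j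
    by (auto simp: term_coeff_def fls_X_power_times_conv_shift)
  have "expansion k p $$ (- int (weight k m)) $$ int (Poly_Mapping.lookup m 2) = (\<Sum>m'\<in>?S. Fract (Poly_Mapping.single m' (Poly_Mapping.lookup p m')) 1)"
    unfolding expansion_nth fls_nth_sum tc sum.inter_filter[OF finite_keys] by (intro sum.cong) (auto simp: tc)
  also have "\<dots> = Fract (\<Sum>m'\<in>?S. Poly_Mapping.single m' (Poly_Mapping.lookup p m')) 1"
    by (induction rule: infinite_finite_induct) (simp_all add: Zero_fract_def)
  also have "\<dots> \<noteq> 0"
  proof -
    have "Poly_Mapping.lookup (\<Sum>m'\<in>?S. Poly_Mapping.single m' (Poly_Mapping.lookup p m')) m = Poly_Mapping.lookup p m"
      using assms by (simp add: lookup_sum lookup_single when_def)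
    then have "(\<Sum>m'\<in>?S. Poly_Mapping.single m' (Poly_Mapping.lookup p m')) \<noteq> 0"
      using assms by (metis in_keys_iff lookup_zero)
    then show ?thesis by (simp add: Zero_fract_def eq_fract)
  qed
  finally show ?thesis by auto
qed

lemma expansion_nonzero: "p \<noteq> 0 \<Longrightarrow> expansion k p \<noteq> 0"
  using expansion_nth_weight_nonzero[of _ p k] by (metis fls_zero_nth keys_eq_empty all_not_in_conv)

lemma Fract_eq_expansion:
  assumes "b \<noteq> 0" "d \<noteq> 0" "Fract a b = Fract c d"
  shows "expansion k a / expansion k b = expansion k c / expansion k d"
proof -
  have "a * d = c * b" using assms by (simp add: eq_fract)
  then have "expansion k a * expansion k d = expansion k c * expansion k b"
    by (simp flip: expansion_mult)
  then show ?thesis using assms by (simp add: frac_eq_eq expansion_nonzero)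
qed

text \<open>
  The extension of the expansion to the field of fractions, possible as no nonzero polynomial is
  mapped to \<open>0\<close>.
\<close>
definition fract_expansion :: "nat \<Rightarrow> 'k::field ratfun \<Rightarrow> 'k ratfun fls fls" where
  "fract_expansion k r = (THE v. \<forall>a b. b \<noteq> 0 \<longrightarrow> r = Fract a b \<longrightarrow> v = expansion k a / expansion k b)"

lemma fract_expansion_Fract:
  assumes "b \<noteq> 0"
  shows "fract_expansion k (Fract a b) = expansion k a / expansion k b"
  unfolding fract_expansion_def
  by (rule the_equality) (use assms Fract_eq_expansion in blast)+

lemma fract_expansion_add: "fract_expansion k (r + s) = fract_expansion k r + fract_expansion k s"
  by (cases r; cases s)
    (simp add: fract_expansion_Fract expansion_add expansion_mult add_frac_eq expansion_nonzero)

lemma fract_expansion_mult: "fract_expansion k (r * s) = fract_expansion k r * fract_expansion k s"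
  by (cases r; cases s) (simp add: fract_expansion_Fract expansion_mult)

lemma fract_expansion_1: "fract_expansion k 1 = 1"
  by (simp add: One_fract_def fract_expansion_Fract expansion_1)

lemma fract_expansion_0: "fract_expansion k 0 = 0"
  by (simp add: Zero_fract_def fract_expansion_Fract)

lemma fract_expansion_uminus: "fract_expansion k (- r) = - fract_expansion k r"
  using fract_expansion_add[of k r "- r"] by (simp add: fract_expansion_0 eq_neg_iff_add_eq_0 add.commute)

lemma fract_expansion_reciprocal: "f \<noteq> 0 \<Longrightarrow> fract_expansion k (1 / Fract f 1) = inverse (expansion k f)"
  by (simp add: One_fract_def fract_expansion_Fract expansion_1 inverse_eq_divide)

lemma expansion_subdegree:
  assumes "m \<in> Poly_Mapping.keys p" "\<And>m'. m' \<in> Poly_Mapping.keys p \<Longrightarrow> weight k m' \<le> weight k m"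
  shows "fls_subdegree (expansion k p) = - int (weight k m)"
proof (rule fls_subdegree_eqI)
  show "expansion k p $$ (- int (weight k m)) \<noteq> 0"
    by (rule expansion_nth_weight_nonzero) fact
  show "expansion k p $$ i = 0" if "i < - int (weight k m)" for i
    using assms(2) that
    by (force simp: expansion_def fls_nth_sum term_expansion_nth intro!: sum.neutral)
qed

lemma range_fls_const_add: "x \<in> range fls_const \<Longrightarrow> y \<in> range fls_const \<Longrightarrow> x + y \<in> range fls_const"
  by (auto simp: fls_plus_const)

lemma range_fls_const_mult: "x \<in> range (fls_const :: 'a::field \<Rightarrow> _) \<Longrightarrow> y \<in> range fls_const \<Longrightarrow> x * y \<in> range fls_const"
  by (auto simp: fls_const_mult_const)

lemma range_fls_const_uminus: "x \<in> range (fls_const :: 'a::ab_group_add \<Rightarrow> _) \<Longrightarrow> - x \<in> range fls_const"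
  by (auto simp flip: fls_const_uminus)

lemma range_fls_const_inverse: "x \<in> range (fls_const :: 'a::field \<Rightarrow> _) \<Longrightarrow> inverse x \<in> range fls_const"
  by (auto simp: fls_inverse_const)

lemma range_fls_const_0: "0 \<in> range fls_const"
  by (metis fls_const_0 rangeI)

lemma range_fls_const_sum: "(\<And>i. i \<in> A \<Longrightarrow> f i \<in> range fls_const) \<Longrightarrow> sum f A \<in> range fls_const"
  by (induction A rule: infinite_finite_induct) (auto simp: range_fls_const_0 range_fls_const_add)

text \<open>
  The constants of the inner series form a subfield, and the recursion for the coefficients of the
  inverse of a power series stays inside it.
\<close>
lemma fps_inverse_const_coeffs:
  fixes f :: "'a::field fls fps"
  assumes "\<And>i. f $ i \<in> range fls_const"
  shows "inverse f $ n \<in> range fls_const"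
proof (induction n rule: less_induct)
  case (less n)
  show ?case
  proof (cases n)
    case 0
    then show ?thesis by (simp add: range_fls_const_inverse assms)
  next
    case (Suc m)
    have "inverse f $ n = - inverse (f $ 0) * (\<Sum>i = 1..n. f $ i * inverse f $ (n - i))"
      by (simp add: Suc fps_inverse_def)
    also have "\<dots> \<in> range fls_const"
      by (intro range_fls_const_mult range_fls_const_uminus range_fls_const_inverse range_fls_const_sum less assms) auto
    finally show ?thesis .
  qed
qed

lemma fls_inverse_const_coeffs:
  fixes u :: "'a::field fls fls"
  assumes "\<And>i. u $$ i \<in> range fls_const"
  shows "inverse u $$ i \<in> range fls_const"
  unfolding fls_inverse_def
  by (auto simp: range_fls_const_0 assms intro!: fps_inverse_const_coeffs)


section \<open>Expansions of elements of a reciprocal complement\<close>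

text \<open>
  The elements of a reciprocal complement satisfy this for every \<open>k\<close>: up to order \<open>t\<^bsup>k-1\<^esup>\<close> they do
  not see the variable of weight \<open>k\<close>.
\<close>
definition constant_below :: "nat \<Rightarrow> 'a::field fls fls \<Rightarrow> bool" where
  "constant_below k u \<longleftrightarrow> (\<forall>i<0. u $$ i = 0) \<and> (\<forall>i<int k. u $$ i \<in> range fls_const)"

text \<open>The subspace \<open>L + L y\<^bsup>-1\<^esup>\<close> of \<open>L((y))\<close>.\<close>
definition constant_plus_pole :: "'a::field fls set" where
  "constant_plus_pole = {fls_const a + fls_const b * fls_X_inv | a b. True}"

lemma constant_plus_pole_add: "x \<in> constant_plus_pole \<Longrightarrow> y \<in> constant_plus_pole \<Longrightarrow> x + y \<in> constant_plus_pole"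
proof -
  assume "x \<in> constant_plus_pole" "y \<in> constant_plus_pole"
  then obtain a b c d where "x = fls_const a + fls_const b * fls_X_inv" "y = fls_const c + fls_const d * fls_X_inv"
    by (auto simp: constant_plus_pole_def)
  then have "x + y = fls_const (a + c) + fls_const (b + d) * fls_X_inv"
    by (simp add: fls_plus_const[symmetric] algebra_simps)
  then show ?thesis unfolding constant_plus_pole_def by blast
qed

lemma constant_plus_pole_const_mult:
  assumes "x \<in> range fls_const" "y \<in> constant_plus_pole"
  shows "x * y \<in> constant_plus_pole"
proof -
  obtain a b c where "x = fls_const a" "y = fls_const b + fls_const c * fls_X_inv"
    using assms by (auto simp: constant_plus_pole_def)
  then have "x * y = fls_const (a * b) + fls_const (a * c) * fls_X_inv"
    by (simp only: fls_const_mult_const[symmetric] distrib_left mult.assoc)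
  then show ?thesis unfolding constant_plus_pole_def by blast
qed

lemma range_fls_const_in_constant_plus_pole: "x \<in> range fls_const \<Longrightarrow> x \<in> constant_plus_pole"
  unfolding constant_plus_pole_def by (force intro: exI[of _ 0])

lemma constant_plus_pole_uminus: "x \<in> constant_plus_pole \<Longrightarrow> - x \<in> constant_plus_pole"
  using constant_plus_pole_const_mult[of "fls_const (- 1)" x] by (simp del: fls_const_uminus add: fls_const_uminus[symmetric]) simp

lemma constant_plus_pole_sum: "(\<And>i. i \<in> A \<Longrightarrow> f i \<in> constant_plus_pole) \<Longrightarrow> sum f A \<in> constant_plus_pole"
  by (induction A rule: infinite_finite_induct)
    (auto intro: constant_plus_pole_add range_fls_const_in_constant_plus_pole range_fls_const_0)

lemma fls_times_nth_regular:
  fixes u v :: "'a::field fls"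
  assumes "\<forall>i<0. u $$ i = 0" "\<forall>i<0. v $$ i = 0"
  shows "(u * v) $$ n = (\<Sum>i=0..n. u $$ i * v $$ (n - i))"
proof -
  have "fls_subdegree u \<ge> 0" "fls_subdegree v \<ge> 0"
    using assms by (metis fls_zero_subdegree linorder_not_le nth_fls_subdegree_nonzero order_refl)+
  then show ?thesis
    unfolding fls_times_nth(2)
    by (intro sum.mono_neutral_left) (auto simp: fls_eq0_below_subdegree)
qed

lemma constant_below_add: "constant_below k u \<Longrightarrow> constant_below k v \<Longrightarrow> constant_below k (u + v)"
  by (auto simp: constant_below_def intro: range_fls_const_add)

lemma constant_below_uminus: "constant_below k u \<Longrightarrow> constant_below k (- u)"
  by (auto simp: constant_below_def intro: range_fls_const_uminus)

lemma constant_below_1: "constant_below k 1"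
  using rangeI[of fls_const 1] by (simp add: constant_below_def range_fls_const_0)

lemma constant_below_mult:
  assumes "constant_below k u" "constant_below k v"
  shows "constant_below k (u * v)"
proof -
  have "(u * v) $$ n = (\<Sum>i=0..n. u $$ i * v $$ (n - i))" for n
    using assms by (intro fls_times_nth_regular) (auto simp: constant_below_def)
  then show ?thesis
    using assms by (auto simp: constant_below_def intro!: range_fls_const_sum range_fls_const_mult)
qed

text \<open>
  Let \<open>d\<close> be the weight of \<open>f\<close>, attained at the monomial \<open>m\<close>, so that the inverse starts at \<open>t\<^sup>d\<close>. If
  \<open>d < k\<close>, then \<open>X\<^sub>2\<close> does not occur in \<open>f\<close> and all coefficients are constant in \<open>y\<close>; if \<open>d > k\<close>, those
  up to \<open>t\<^sup>k\<close> vanish. If \<open>d = k\<close>, the coefficient at \<open>t\<^sup>k\<close> is the inverse of the leading form of \<open>f\<close>. A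
  monomial of weight \<open>k\<close> contains either \<open>X\<^sub>2\<close> exactly once or \<open>X\<^sub>1\<^sup>k\<close>, and the latter is excluded when
  all exponents of \<open>X\<^sub>1\<close> are less than \<open>k\<close>, so that then the leading form is \<open>y\<close> times a constant.
\<close>
lemma constant_below_inverse_expansion:
  assumes "f \<noteq> 0"
  shows "constant_below k (inverse (expansion k f))"
    and "(\<And>m. m \<in> Poly_Mapping.keys f \<Longrightarrow> Poly_Mapping.lookup m 1 < k) \<Longrightarrow>
      inverse (expansion k f) $$ int k \<in> constant_plus_pole"
proof -
  let ?u = "inverse (expansion k f)"
  have "weight k ` Poly_Mapping.keys f \<noteq> {}" using assms by simp
  then have "Max (weight k ` Poly_Mapping.keys f) \<in> weight k ` Poly_Mapping.keys f"
    by (intro Max_in) simp_all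
  then obtain m where m: "m \<in> Poly_Mapping.keys f" "weight k m = Max (weight k ` Poly_Mapping.keys f)"
    by auto
  have max: "weight k m' \<le> weight k m" if "m' \<in> Poly_Mapping.keys f" for m'
    using that by (simp add: m(2))
  have sub: "fls_subdegree (expansion k f) = - int (weight k m)"
    using m(1) max by (rule expansion_subdegree)
  have below: "?u $$ i = 0" if "i < int (weight k m)" for i
    using that by (intro fls_eq0_below_subdegree) (simp add: sub)
  have const: "?u $$ i \<in> range fls_const" if "weight k m < k" for i
  proof (rule fls_inverse_const_coeffs)
    have "Poly_Mapping.lookup m' 2 = 0" if "m' \<in> Poly_Mapping.keys f" for m'
      using max[OF that] \<open>weight k m < k\<close> by (cases "Poly_Mapping.lookup m' 2") (auto simp: weight_def)
    then show "expansion k f $$ i \<in> range fls_const" for i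
      by (auto simp: expansion_def fls_nth_sum term_expansion_nth term_coeff_def
          intro!: range_fls_const_sum range_fls_const_0)
  qed
  show "constant_below k ?u"
    unfolding constant_below_def
  proof safe
    show "?u $$ i = 0" if "i < 0" for i using that by (intro below) simp
    show "?u $$ i \<in> range fls_const" if "i < int k" for i
      using below[of i] const[of i] that range_fls_const_0 by (cases "i < int (weight k m)") auto
  qed
  assume small: "\<And>m. m \<in> Poly_Mapping.keys f \<Longrightarrow> Poly_Mapping.lookup m 1 < k"
  consider "weight k m < k" | "weight k m > k" | "weight k m = k" by linarith
  then show "?u $$ int k \<in> constant_plus_pole"
  proof cases
    case 1
    then show ?thesis using const by (intro range_fls_const_in_constant_plus_pole)
  next
    case 2
    then show ?thesis using below[of "int k"] by (simp add: range_fls_const_in_constant_plus_pole range_fls_const_0)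
  next
    case 3
    have lookup: "Poly_Mapping.lookup m' 2 = 1" if "m' \<in> Poly_Mapping.keys f" "weight k m' = k" for m'
    proof -
      have "Poly_Mapping.lookup m' 1 < k" using small that by simp
      then have "0 < k" "Poly_Mapping.lookup m' 2 \<noteq> 0"
        using that(2) by (simp, intro notI) (simp add: weight_def)
      moreover have "k * Poly_Mapping.lookup m' 2 \<le> k * 1"
        using that(2) unfolding weight_def by linarith
      ultimately show ?thesis using mult_le_cancel1[of k "Poly_Mapping.lookup m' 2" 1] by linarith
    qed
    have "expansion k f $$ (- int k) \<in> (\<lambda>c. fls_X * c) ` range fls_const"
    proof -
      have "expansion k f $$ (- int k) =
          fls_X * (\<Sum>m'\<in>{m' \<in> Poly_Mapping.keys f. weight k m' = k}. fls_const (Fract (Poly_Mapping.single m' (Poly_Mapping.lookup f m')) 1))"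
        unfolding expansion_nth sum_distrib_left
        by (intro sum.cong refl) (simp add: term_coeff_def lookup)
      then show ?thesis by (auto intro!: range_fls_const_sum imageI)
    qed
    then obtain c where "expansion k f $$ (- int k) = fls_X * fls_const c" by auto
    moreover have "?u $$ int k = inverse (expansion k f $$ (- int k))"
      using fls_inverse_base[OF expansion_nonzero[OF assms], of k] by (simp add: sub 3)
    ultimately have "?u $$ int k = fls_const 0 + fls_const (inverse c) * fls_X_inv"
      by (simp add: fls_inverse_const fls_inverse_X inverse_mult_distrib mult.commute)
    then show ?thesis unfolding constant_plus_pole_def by blast
  qed
qed

text \<open>
  In the Cauchy product at \<open>t\<^sup>k\<close> only the two extreme summands involve a coefficient at \<open>t\<^sup>k\<close>, and its
  cofactor is a coefficient at \<open>t\<^sup>0\<close>, hence constant in \<open>y\<close>. The alternative in the last assumption serves two purposes: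
  it yields closure under products and, with \<open>v $$ 0 = 0\<close>, absorption of
  arbitrary multipliers.
\<close>
lemma constant_plus_pole_times_nth:
  assumes u: "constant_below k u" and v: "constant_below k v" and k: "0 < k"
    and vk: "v $$ int k \<in> constant_plus_pole" and uk: "u $$ int k \<in> constant_plus_pole \<or> v $$ 0 = 0"
  shows "(u * v) $$ int k \<in> constant_plus_pole"
proof -
  have "(u * v) $$ int k = (\<Sum>i=0..int k. u $$ i * v $$ (int k - i))"
    using u v by (intro fls_times_nth_regular) (auto simp: constant_below_def)
  also have "\<dots> \<in> constant_plus_pole"
  proof (rule constant_plus_pole_sum)
    fix i assume "i \<in> {0..int k}"
    then consider "i = 0" | "i = int k" | "0 < i" "i < int k" by fastforce
    then show "u $$ i * v $$ (int k - i) \<in> constant_plus_pole"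
    proof cases
      case 1
      then show ?thesis
        using u vk k by (simp add: constant_below_def constant_plus_pole_const_mult)
    next
      case 2
      moreover have "v $$ 0 \<in> range fls_const" using v k by (simp add: constant_below_def)
      ultimately show ?thesis
        using uk constant_plus_pole_const_mult[of "v $$ 0" "u $$ int k"] range_fls_const_0[THEN range_fls_const_in_constant_plus_pole]
        by (auto simp: mult.commute)
    next
      case 3
      then show ?thesis
        using u v by (intro range_fls_const_in_constant_plus_pole range_fls_const_mult) (simp_all add: constant_below_def)
    qed
  qed
  finally show ?thesis .
qed

text \<open>
  Both properties hold for the reciprocals that generate the ring and are preserved by the ring
  operations; the bound from which on the second one holds depends on the element.
\<close>
lemma carrier_reciprocal_complement_expansion:
  assumes "r \<in> carrier (reciprocal_complement (T :: ((nat \<Rightarrow>\<^sub>0 nat) \<Rightarrow>\<^sub>0 'k::field) set))"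
  shows "constant_below k (fract_expansion k r)"
    and "\<forall>\<^sub>F k in sequentially. fract_expansion k r $$ int k \<in> constant_plus_pole"
proof -
  let ?F = "ring_of_type_algebra :: ((nat \<Rightarrow>\<^sub>0 nat) \<Rightarrow>\<^sub>0 'k) fract ring"
  interpret F: ring ?F by (rule ring_from_type_algebra)
  have ops: "x \<oplus>\<^bsub>?F\<^esub> y = x + y" "x \<otimes>\<^bsub>?F\<^esub> y = x * y" "\<one>\<^bsub>?F\<^esub> = 1" for x y
    by (simp_all add: ring_of_type_algebra_def)
  have neg: "\<ominus>\<^bsub>?F\<^esub> x = - x" for x
    by (rule F.minus_equality) (simp_all add: ring_of_type_algebra_def)
  have r: "r \<in> generate_ring ?F {1 / Fract f 1 | f. f \<in> T - {0}}"
    using assms by (simp add: reciprocal_complement_def)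
  have below: "constant_below k (fract_expansion k h)"
    if "h \<in> generate_ring ?F {1 / Fract f 1 | f. f \<in> T - {0}}" for k h
    using that
    by (induction rule: generate_ring.induct)
      (auto simp: ops neg fract_expansion_1 fract_expansion_uminus fract_expansion_add fract_expansion_mult
        fract_expansion_reciprocal constant_below_1 constant_below_uminus constant_below_add
        constant_below_mult constant_below_inverse_expansion)
  show "constant_below k (fract_expansion k r)" using r by (rule below)
  show "\<forall>\<^sub>F k in sequentially. fract_expansion k r $$ int k \<in> constant_plus_pole"
    using r
  proof (induction rule: generate_ring.induct)
    case one
    have "1 $$ int k \<in> constant_plus_pole" for k
      using rangeI[of fls_const 1] by (intro range_fls_const_in_constant_plus_pole) (simp add: range_fls_const_0)
    then show ?case unfolding ops fract_expansion_1 by (intro always_eventually allI)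
  next
    case (incl h)
    then obtain f where f: "f \<noteq> 0" "h = 1 / Fract f 1" by auto
    have "\<forall>\<^sub>F k in sequentially. \<forall>m\<in>Poly_Mapping.keys f. Poly_Mapping.lookup m 1 < k"
      by (intro eventually_ball_finite ballI eventually_gt_at_top) simp
    then show ?case
      by eventually_elim
        (simp add: f fract_expansion_reciprocal constant_below_inverse_expansion(2))
  next
    case (a_inv h)
    from a_inv.IH show ?case
      by eventually_elim (simp add: neg fract_expansion_uminus constant_plus_pole_uminus)
  next
    case (eng_add h1 h2)
    from eng_add.IH show ?case
      by eventually_elim (simp add: ops fract_expansion_add constant_plus_pole_add)
  next
    case (eng_mult h1 h2)
    from eng_mult.IH eventually_gt_at_top[of 0] show ?case
    proof eventually_elim
      case (elim k)
      then show ?case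
        using below[OF eng_mult.hyps(1)] below[OF eng_mult.hyps(2)]
        by (auto simp: ops fract_expansion_mult intro!: constant_plus_pole_times_nth)
    qed
  qed
qed


text \<open>
  In \<open>(a + b y) (c + d y\<^bsup>-1\<^esup>)\<close> the coefficients at \<open>y\<close> and \<open>y\<^bsup>-1\<^esup>\<close> are \<open>b c\<close> and \<open>a d\<close>, so this product could only
  be \<open>1\<close> for \<open>c = d = 0\<close>.
\<close>
lemma inverse_linear_not_constant_plus_pole:
  assumes "a \<noteq> 0" "b \<noteq> (0 :: 'a::field)"
  shows "inverse (fls_const a + fls_const b * fls_X) \<notin> constant_plus_pole"
proof
  assume "inverse (fls_const a + fls_const b * fls_X) \<in> constant_plus_pole"
  then obtain c d where cd: "inverse (fls_const a + fls_const b * fls_X) = fls_const c + fls_const d * fls_X_inv"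
    by (auto simp: constant_plus_pole_def)
  have nth: "(fls_const a + fls_const b * fls_X) $$ 0 = a" by simp
  then have "fls_const a + fls_const b * fls_X \<noteq> 0" using assms by (metis fls_zero_nth)
  then have "1 = (fls_const a + fls_const b * fls_X) * (fls_const c + fls_const d * fls_X_inv)"
    using cd by (metis right_inverse)
  also have "\<dots> = fls_const (a * c) + fls_const (b * c) * fls_X + fls_const (a * d) * fls_X_inv
      + fls_const (b * d) * (fls_X * fls_X_inv)"
    by (simp only: fls_const_mult_const[symmetric]) (simp only: algebra_simps)
  also have "fls_X * fls_X_inv = (1 :: 'a fls)"
    by (simp add: fls_X_times_conv_shift fls_X_inv_conv_shift_1)
  finally have eq: "1 = fls_const (a * c) + fls_const (b * c) * fls_X + fls_const (a * d) * fls_X_inv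
      + fls_const (b * d)" by simp
  from arg_cong[OF eq, of "\<lambda>u. u $$ 1"] have "b * c = 0" by simp
  moreover from arg_cong[OF eq, of "\<lambda>u. u $$ (-1)"] have "a * d = 0" by simp
  ultimately show False using eq assms by simp
qed


section \<open>An ideal that is not finitely generated\<close>

text \<open>The power \<open>X\<^sub>i\<^sup>j\<close> of a variable.\<close>
definition var_pow :: "nat \<Rightarrow> nat \<Rightarrow> (nat \<Rightarrow>\<^sub>0 nat) \<Rightarrow>\<^sub>0 'k::field" where
  "var_pow i j = Poly_Mapping.single (Poly_Mapping.single i j) 1"

lemma expansion_var_pow:
  "expansion k (var_pow 1 i) = fls_X_inv ^ i * fls_const (fls_const (Fract (var_pow 1 i) 1))"
  "expansion k (var_pow 2 1) = fls_X_inv ^ k * fls_const (fls_X * fls_const (Fract (var_pow 2 1) 1))"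
  by (simp_all add: var_pow_def expansion_single term_expansion_def term_coeff_def weight_def lookup_single)

lemma var_pow_nonzero: "var_pow i j \<noteq> 0"
  by (metis var_pow_def lookup_single_eq lookup_zero one_neq_zero)

lemma var_pow_mult: "var_pow v i * var_pow v j = var_pow v (i + j)"
  by (simp add: var_pow_def mult_single single_add)

lemma var_pow_sum_nonzero: "var_pow 1 i + var_pow 2 1 \<noteq> (0 :: (nat \<Rightarrow>\<^sub>0 nat) \<Rightarrow>\<^sub>0 'k::field)"
proof
  assume "var_pow 1 i + var_pow 2 1 = (0 :: (nat \<Rightarrow>\<^sub>0 nat) \<Rightarrow>\<^sub>0 'k)"
  then have "Poly_Mapping.lookup (var_pow 1 i + var_pow 2 1) (Poly_Mapping.single 2 1) = (0 :: 'k)"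
    by simp
  moreover have "Poly_Mapping.single 1 i \<noteq> Poly_Mapping.single (2::nat) (1::nat)"
    by (metis lookup_single_eq lookup_single_not_eq one_neq_zero n_not_Suc_n numeral_2_eq_2 One_nat_def)
  ultimately show False
    by (simp add: var_pow_def lookup_add lookup_single)
qed

lemma var_pow_polynomials: "v \<in> {1..n} \<Longrightarrow> var_pow v i \<in> polynomials n"
  by (simp add: var_pow_def polynomials_def)

text \<open>
  Compare the coefficients at \<open>t\<^bsup>-1\<^esup>\<close> in \<open>r X\<^sub>1 = s X\<^sub>2\<close>. On the left stands the constant coefficient of
  \<open>r\<close> times \<open>X\<^sub>1\<close>, on the right the coefficient of \<open>s\<close> at \<open>t\<^bsup>k-1\<^esup>\<close> times \<open>X\<^sub>2 y\<close>. Since both coefficients are constant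
  in \<open>y\<close>, the left side is a constant and the right side a constant times \<open>y\<close>, so both vanish.
\<close>
lemma colon_constant_term:
  fixes r s :: "'k::field ratfun"
  assumes r: "constant_below k (fract_expansion k r)" and s: "constant_below k (fract_expansion k s)"
    and k: "0 < k"
    and rs: "r * (1 / Fract (var_pow 2 1) 1) = s * (1 / Fract (var_pow 1 1) 1)"
  shows "fract_expansion k r $$ 0 = 0"
proof -
  let ?x = "Fract (var_pow 1 1) 1 :: 'k ratfun" and ?y = "Fract (var_pow 2 1) 1 :: 'k ratfun"
  have nz: "?x \<noteq> 0" "?y \<noteq> 0"
    by (simp_all add: Zero_fract_def eq_fract var_pow_nonzero)
  then have eq: "r * ?x = s * ?y" using rs frac_eq_eq[of ?y ?x r s] by simp
  have xy: "fract_expansion k ?x = expansion k (var_pow 1 1)" "fract_expansion k ?y = expansion k (var_pow 2 1)"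
    by (simp_all add: fract_expansion_Fract expansion_1)
  have "fract_expansion k r * expansion k (var_pow 1 1) = fract_expansion k s * expansion k (var_pow 2 1)"
    using arg_cong[OF eq, of "fract_expansion k"] by (simp only: fract_expansion_mult xy)
  then have "fls_X_inv ^ 1 * (fract_expansion k r * fls_const (fls_const ?x))
      = fls_X_inv ^ k * (fract_expansion k s * fls_const (fls_X * fls_const ?y))"
    unfolding expansion_var_pow by (simp only: mult.left_commute)
  then have "(fls_X_inv ^ 1 * (fract_expansion k r * fls_const (fls_const ?x))) $$ (- 1)
      = (fls_X_inv ^ k * (fract_expansion k s * fls_const (fls_X * fls_const ?y))) $$ (- 1)"
    by simp
  then have "fract_expansion k r $$ 0 * fls_const ?x = fract_expansion k s $$ (int k - 1) * (fls_X * fls_const ?y)"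
    by (simp add: fls_X_inv_power_times_conv_shift fls_X_inv_times_conv_shift)
  moreover have "fract_expansion k r $$ 0 \<in> range fls_const" "fract_expansion k s $$ (int k - 1) \<in> range fls_const"
    using r s k by (simp_all add: constant_below_def)
  then obtain c d where cd: "fract_expansion k r $$ 0 = fls_const c" "fract_expansion k s $$ (int k - 1) = fls_const d"
    by (elim imageE)
  ultimately have "fls_const c * fls_const ?x = fls_X * (fls_const d * fls_const ?y)"
    by (simp only: mult.left_commute)
  then have "fls_const (c * ?x) = fls_X * fls_const (d * ?y)"
    by (simp only: fls_const_mult_const)
  from arg_cong[OF this, of "\<lambda>u. u $$ 0"] have "c * ?x = 0" by (simp add: fls_X_times_conv_shift)
  then show ?thesis using nz cd by simp
qed

lemma fract_expansion_witness:
  "fract_expansion k (1 / Fract (var_pow 1 k + var_pow 2 1) 1 :: 'k::field ratfun) $$ int k \<notin> constant_plus_pole"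
proof -
  let ?a = "Fract (var_pow 1 k) 1 :: 'k ratfun" and ?b = "Fract (var_pow 2 1) 1 :: 'k ratfun"
  have "expansion k (var_pow 1 k + var_pow 2 1)
      = fls_X_inv ^ k * fls_const (fls_const ?a + fls_const ?b * fls_X)"
    by (simp only: expansion_add expansion_var_pow fls_plus_const[symmetric] distrib_left mult.commute[of fls_X])
  then have "fract_expansion k (1 / Fract (var_pow 1 k + var_pow 2 1) 1)
      = inverse (fls_X_inv ^ k * fls_const (fls_const ?a + fls_const ?b * fls_X))"
    by (simp only: fract_expansion_reciprocal[OF var_pow_sum_nonzero])
  also have "\<dots> = fls_X ^ k * fls_const (inverse (fls_const ?a + fls_const ?b * fls_X))"
    by (simp only: inverse_mult_distrib power_inverse[symmetric] fls_inverse_X_inv fls_inverse_const)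
  finally have "fract_expansion k (1 / Fract (var_pow 1 k + var_pow 2 1) 1)
      = fls_X ^ k * fls_const (inverse (fls_const ?a + fls_const ?b * fls_X))" .
  then have "fract_expansion k (1 / Fract (var_pow 1 k + var_pow 2 1) 1) $$ int k
      = inverse (fls_const ?a + fls_const ?b * fls_X)"
    by (simp add: fls_X_power_times_conv_shift)
  moreover have "?a \<noteq> 0" "?b \<noteq> 0"
    by (simp_all add: Zero_fract_def eq_fract var_pow_nonzero)
  ultimately show ?thesis using inverse_linear_not_constant_plus_pole by metis
qed

lemma reciprocal_complement_ops:
  fixes T :: "'a::idom set"
  shows "x \<oplus>\<^bsub>reciprocal_complement T\<^esub> y = x + y" "x \<otimes>\<^bsub>reciprocal_complement T\<^esub> y = x * y"
    "\<zero>\<^bsub>reciprocal_complement T\<^esub> = 0" "\<one>\<^bsub>reciprocal_complement T\<^esub> = 1"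
  by (simp_all add: reciprocal_complement_def ring_of_type_algebra_def)

lemma reciprocal_mem:
  "f \<in> T \<Longrightarrow> f \<noteq> 0 \<Longrightarrow> 1 / Fract f 1 \<in> carrier (reciprocal_complement T)"
  by (auto simp: reciprocal_complement_def intro!: generate_ring.incl)

lemma reciprocal_complement_a_inv:
  assumes "x \<in> carrier (reciprocal_complement T)"
  shows "\<ominus>\<^bsub>reciprocal_complement T\<^esub> x = - x"
proof -
  interpret domain "reciprocal_complement T" by (rule reciprocal_complement_domain)
  have "x + \<ominus>\<^bsub>reciprocal_complement T\<^esub> x = 0"
    using r_neg[OF assms] by (simp only: reciprocal_complement_ops)
  then show ?thesis by (simp add: eq_neg_iff_add_eq_0 add.commute)
qed

text \<open>
  The vanishing constant coefficient is what makes this set absorb multipliers whose own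
  coefficient at \<open>t\<^sup>k\<close> is arbitrary.
\<close>
lemma truncation_ideal:
  fixes T :: "((nat \<Rightarrow>\<^sub>0 nat) \<Rightarrow>\<^sub>0 'k::field) set"
  assumes k: "0 < k"
  shows "ideal {r \<in> carrier (reciprocal_complement T).
      fract_expansion k r $$ 0 = 0 \<and> fract_expansion k r $$ int k \<in> constant_plus_pole} (reciprocal_complement T)"
    (is "ideal ?Q ?R")
proof -
  interpret domain ?R by (rule reciprocal_complement_domain)
  note below = carrier_reciprocal_complement_expansion(1)
  show ?thesis
  proof (rule ideal_if_closed)
    have "0 \<in> carrier ?R" using zero_closed by (simp add: reciprocal_complement_ops)
    then have "0 \<in> ?Q"
      using range_fls_const_in_constant_plus_pole[OF range_fls_const_0] by (simp add: fract_expansion_0)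
    then show "?Q \<noteq> {}"
      by blast
  next
    fix r s
    assume "r \<in> ?Q"
      "s \<in> ?Q"
    moreover from this have "r \<oplus>\<^bsub>?R\<^esub> s \<in> carrier ?R" by auto
    ultimately show "r \<oplus>\<^bsub>?R\<^esub> s \<in> ?Q"
      by (simp add: reciprocal_complement_ops fract_expansion_add constant_plus_pole_add)
  next
    fix c r
    assume c: "c \<in> carrier ?R"
      and r: "r \<in> ?Q"
    have "c \<otimes>\<^bsub>?R\<^esub> r \<in> carrier ?R" using c r by auto
    moreover have cr: "constant_below k (fract_expansion k c)" "constant_below k (fract_expansion k r)"
      using c r by (auto intro: below)
    moreover have "(fract_expansion k c * fract_expansion k r) $$ 0 = 0"
      using cr r by (subst fls_times_nth_regular) (auto simp: constant_below_def)
    ultimately show "c \<otimes>\<^bsub>?R\<^esub> r \<in> ?Q"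
      using r k by (simp add: reciprocal_complement_ops fract_expansion_mult constant_plus_pole_times_nth)
  qed auto
qed

text \<open>
  For large \<open>k\<close> the ideal of \<open>truncation_ideal\<close> contains \<open>G\<close> but not \<open>1 / (X\<^sub>1\<^sup>k + X\<^sub>2)\<close>, which lies in the colon
  ideal.
\<close>
lemma colon_not_finitely_generated:
  fixes n :: nat
  defines "R \<equiv> reciprocal_complement (polynomials n :: ((nat \<Rightarrow>\<^sub>0 nat) \<Rightarrow>\<^sub>0 'k::field) set)"
  assumes n: "n \<ge> 2" and G: "G \<subseteq> carrier R" "finite G"
  shows "{r \<in> carrier R. \<exists>s\<in>carrier R. r \<otimes>\<^bsub>R\<^esub> (1 / Fract (var_pow 2 1) 1)
      = s \<otimes>\<^bsub>R\<^esub> (1 / Fract (var_pow 1 1) 1)} \<noteq> Idl\<^bsub>R\<^esub> G" (is "?J \<noteq> _")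
proof
  assume J: "?J = Idl\<^bsub>R\<^esub> G"
  interpret domain R unfolding R_def by (rule reciprocal_complement_domain)
  note ops = reciprocal_complement_ops[where T = "polynomials n :: ((nat \<Rightarrow>\<^sub>0 nat) \<Rightarrow>\<^sub>0 'k) set", folded R_def]
  note mem = reciprocal_mem[where T = "polynomials n :: ((nat \<Rightarrow>\<^sub>0 nat) \<Rightarrow>\<^sub>0 'k) set", folded R_def]
  note expand = carrier_reciprocal_complement_expansion[where T = "polynomials n :: ((nat \<Rightarrow>\<^sub>0 nat) \<Rightarrow>\<^sub>0 'k) set", folded R_def]
  have "\<forall>\<^sub>F k in sequentially. \<forall>g\<in>G. fract_expansion k g $$ int k \<in> constant_plus_pole"
    using G by (intro eventually_ball_finite ballI expand(2)) auto
  with eventually_gt_at_top[of 0]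
  have "\<forall>\<^sub>F k in sequentially. 0 < k \<and> (\<forall>g\<in>G. fract_expansion k g $$ int k \<in> constant_plus_pole)"
    by eventually_elim blast
  then obtain k where k: "0 < k" "\<forall>g\<in>G. fract_expansion k g $$ int k \<in> constant_plus_pole"
    by (auto simp: eventually_sequentially)
  let ?Q = "{r \<in> carrier R. fract_expansion k r $$ 0 = 0 \<and> fract_expansion k r $$ int k \<in> constant_plus_pole}"
  have "G \<subseteq> ?Q"
  proof
    fix g assume g: "g \<in> G"
    then have "g \<in> ?J" using genideal_self[OF G(1)] J by blast
    then obtain s where s: "g \<in> carrier R" "s \<in> carrier R"
      "g * (1 / Fract (var_pow 2 1) 1) = s * (1 / Fract (var_pow 1 1) 1)"
      by (auto simp: ops)
    then have "fract_expansion k g $$ 0 = 0"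
      using k(1) by (intro colon_constant_term expand(1)) 
    then show "g \<in> ?Q" using s k g by simp
  qed
  then have JQ: "?J \<subseteq> ?Q"
    unfolding J using truncation_ideal[OF k(1), where T = "polynomials n :: ((nat \<Rightarrow>\<^sub>0 nat) \<Rightarrow>\<^sub>0 'k) set", folded R_def] by (intro genideal_minimal)
  let ?x = "Fract (var_pow 1 1) 1 :: 'k ratfun" and ?y = "Fract (var_pow 2 1) 1 :: 'k ratfun"
    and ?z = "Fract (var_pow 1 (k - 1)) 1 :: 'k ratfun"
    and ?q = "1 / Fract (var_pow 1 k + var_pow 2 1) 1 :: 'k ratfun"
  have poly: "var_pow 1 i \<in> polynomials n" "var_pow 2 i \<in> polynomials n" for i
    using n by (auto intro: var_pow_polynomials)
  have "Poly_Mapping.keys (var_pow 1 k + var_pow 2 1 :: (nat \<Rightarrow>\<^sub>0 nat) \<Rightarrow>\<^sub>0 'k)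
      \<subseteq> {Poly_Mapping.single 1 k, Poly_Mapping.single 2 1}"
    by (rule order_trans[OF Poly_Mapping.keys_add]) (simp add: var_pow_def)
  then have "var_pow 1 k + var_pow 2 1 \<in> (polynomials n :: ((nat \<Rightarrow>\<^sub>0 nat) \<Rightarrow>\<^sub>0 'k) set)"
    using n by (fastforce simp: polynomials_def split: if_splits)
  then have q: "?q \<in> carrier R" by (intro mem var_pow_sum_nonzero)
  have yz: "1 / ?y \<in> carrier R" "1 / ?z \<in> carrier R"
    using poly by (auto intro!: mem var_pow_nonzero simp del: divide_fract)
  have "?q \<in> ?J"
  proof -
    \<comment> \<open>partial fractions: \<open>s = x / (y (x\<^sup>k + y))\<close>\<close>
    define s where "s = (1 / ?z) * (1 / ?y - ?q)"
    have "1 / ?y - ?q \<in> carrier R"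
      using a_closed[OF yz(1) a_inv_closed[OF q]] q
        reciprocal_complement_a_inv[of ?q "polynomials n :: ((nat \<Rightarrow>\<^sub>0 nat) \<Rightarrow>\<^sub>0 'k) set", folded R_def] by (simp add: ops)
    then have s: "s \<in> carrier R"
      unfolding s_def using m_closed[OF yz(2)] by (simp add: ops)
    have nz: "?x \<noteq> 0" "?y \<noteq> 0" "?z \<noteq> 0" "Fract (var_pow 1 k + var_pow 2 1) 1 \<noteq> (0 :: 'k ratfun)"
      using var_pow_sum_nonzero
      by (simp_all add: Zero_fract_def eq_fract var_pow_nonzero)
    have sum: "Fract (var_pow 1 k + var_pow 2 1) 1 = ?x * ?z + ?y"
      using k by (simp add: var_pow_mult)
    have "?q * (1 / ?y) = s * (1 / ?x)"
      unfolding s_def sum using nz[unfolded sum] by (simp add: field_simps del: mult_fract add_fract divide_fract)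
    then show ?thesis using q s by (auto simp: ops)
  qed
  then show False using JQ fract_expansion_witness[of k] by blast
qed

theorem corollary5p7:
  fixes n :: nat
  assumes "n \<ge> 2"
  shows "\<not> coherent_ring
             (reciprocal_complement (polynomials n :: ((nat \<Rightarrow>\<^sub>0 nat) \<Rightarrow>\<^sub>0 'k::field) set)) \<and>
         \<not> noetherian_ring
             (reciprocal_complement (polynomials n :: ((nat \<Rightarrow>\<^sub>0 nat) \<Rightarrow>\<^sub>0 'k::field) set))"
proof -
  let ?R = "reciprocal_complement (polynomials n :: ((nat \<Rightarrow>\<^sub>0 nat) \<Rightarrow>\<^sub>0 'k::field) set)"
  interpret domain ?R by (rule reciprocal_complement_domain)
  let ?a = "1 / Fract (var_pow 2 1) 1 :: 'k ratfun" and ?b = "1 / Fract (var_pow 1 1) 1 :: 'k ratfun"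
  have a: "?a \<in> carrier ?R" and b: "?b \<in> carrier ?R"
    using assms by (auto intro!: reciprocal_mem var_pow_nonzero var_pow_polynomials simp del: divide_fract)
  note not_fg = colon_not_finitely_generated[OF assms, where 'k = 'k]
  show ?thesis
  proof (intro conjI notI)
    assume "coherent_ring ?R"
    from coherent_colon_finitely_generated[OF this a b] not_fg show False by blast
  next
    assume "noetherian_ring ?R"
    from noetherian_ring.finetely_gen[OF this colon_ideal[OF a b]] not_fg show False by blast
  qed
qed

end
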